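(* Let $(A,b)$ be a linear system in $\mathbb{F}_2^n$ with $m=2^{Cn/\log n}$ equations such that each row $a_1,\dots,a_m\in\mathbb{F}_2^n$ of $A$ is generated by independently setting each coordinate $(a_i)_j=1$ with probability $q=\lambda\cdot\frac{8C\ln 2}{\log n}$, for some $1<\lambda\leq o(\log n)$, and $(a_i)_j=0$ with probability $1-q$. For all $1\leq i\leq m$ define the polynomial $p_i(x)=\prod_{j:(a_i)_j=1}x_j$. Then with high probability there exists a degree-$\Omega(n)$ pseudo-expectation $\tilde{\mathbb{E}}$ over $\{\pm1\}^n$ such that $\tilde{\mathbb{E}}[p_i(x)]=(-1)^{b_i}$ for all $i\in[m]$.
   Context: A linear system in $\mathbb{F}_2^n$ with $m$ equations is a pair $(A,b)\in\mathbb{F}_2^{m\times n}\times\mathbb{F}_2^m$, representing the equations $\langle a_i,x\rangle=b_i$, $i\in[m]$; no condition is imposed on the right-hand side $b$. Here $C>0$ is a constant, $\lambda=\lambda(n)$ may depend on $n$, $\log$ is base 2, $\ln$ is the natural logarithm, all coordinates $(a_i)_j$ are mutually independent, and "with high probability" means with probability $1-o(1)$ as $n\to\infty$. For $d\geq2$, a degree-$d$ pseudo-expectation over $\{\pm1\}^n$ is a linear functional $\tilde{\mathbb{E}}:\mathbb{R}[x_1,\dots,x_n]_{\leq d}\to\mathbb{R}$ (on polynomials of degree at most $d$) such that: (i) $\tilde{\mathbb{E}}[1]=1$; (ii) $\tilde{\mathbb{E}}[f x_i^2]=\tilde{\mathbb{E}}[f]$ for all $i\in[n]$ and $f\in\mathbb{R}[x_1,\dots,x_n]_{\leq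 d-2}$; (iii) $\tilde{\mathbb{E}}[f^2]\geq0$ for all $f\in\mathbb{R}[x_1,\dots,x_n]_{\leq d/2}$. *)

theory Defs
  imports "HOL-Probability.Probability" "HOL-Library.Poly_Mapping" "HOL-Library.Z2"
    "HOL-Library.Landau_Symbols"
begin

text \<open>Real multivariate polynomials are finitely supported maps from monomials (themselves finitely
  supported exponent vectors) to coefficients; multiplication on
  \<^typ>\<open>(nat \<Rightarrow>\<^sub>0 nat) \<Rightarrow>\<^sub>0 real\<close> is the convolution product. The variables
  \<open>x_1, \<dots>, x_n\<close> and the equations \<open>1, \<dots>, m\<close> are indexed from \<open>0\<close>.\<close>

type_synonym mpoly_real = "(nat \<Rightarrow>\<^sub>0 nat) \<Rightarrow>\<^sub>0 real"

definition mvar :: "nat \<Rightarrow> mpoly_real" where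
  "mvar j = Poly_Mapping.single (Poly_Mapping.single j 1) 1"

definition mconst :: "real \<Rightarrow> mpoly_real" where
  "mconst c = Poly_Mapping.single 0 c"

definition monom_degree :: "(nat \<Rightarrow>\<^sub>0 nat) \<Rightarrow> nat" where
  "monom_degree t = (\<Sum>j\<in>Poly_Mapping.keys t. Poly_Mapping.lookup t j)"

text \<open>The space of polynomials in \<open>n\<close> variables of total degree at most \<open>d\<close>.\<close>

definition polys_upto :: "nat \<Rightarrow> nat \<Rightarrow> mpoly_real set" where
  "polys_upto n d =
     {f. \<forall>t\<in>Poly_Mapping.keys f. Poly_Mapping.keys t \<subseteq> {..<n} \<and> monom_degree t \<le> d}"

text \<open>Only the values of \<open>E\<close> on \<^term>\<open>polys_upto n d\<close> are constrained; outside this space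
  \<open>E\<close> is a meaningless completion to a total function.\<close>

definition pseudo_expectation :: "nat \<Rightarrow> nat \<Rightarrow> (mpoly_real \<Rightarrow> real) \<Rightarrow> bool" where
  "pseudo_expectation n d E \<longleftrightarrow>
     2 \<le> d \<and>
     (\<forall>f\<in>polys_upto n d. \<forall>g\<in>polys_upto n d. E (f + g) = E f + E g) \<and>
     (\<forall>c. \<forall>f\<in>polys_upto n d. E (mconst c * f) = c * E f) \<and>
     E 1 = 1 \<and>
     (\<forall>i<n. \<forall>f\<in>polys_upto n (d - 2). E (f * mvar i ^ 2) = E f) \<and>
     (\<forall>f\<in>polys_upto n (d div 2). 0 \<le> E (f ^ 2))"

definition row_poly :: "nat \<Rightarrow> (nat \<Rightarrow> bit) \<Rightarrow> mpoly_real" where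
  "row_poly n a = (\<Prod>j\<in>{j. j < n \<and> a j = 1}. mvar j)"

text \<open>A matrix over the two-element field is a function \<open>A\<close> with rows \<open>A i\<close> (\<open>i < m\<close>) and entries
  \<open>A i j\<close> (\<open>j < n\<close>), equal to \<open>0\<close> outside this range. All entries are independent, and each
  equals \<open>1\<close> with probability \<open>q\<close>. Note that \<^const>\<open>bernoulli_pmf\<close> clamps its parameter to
  \<open>[0, 1]\<close>.\<close>

definition random_row :: "nat \<Rightarrow> real \<Rightarrow> (nat \<Rightarrow> bit) pmf" where
  "random_row n q = Pi_pmf {..<n} 0 (\<lambda>_. map_pmf of_bool (bernoulli_pmf q))"

definition random_matrix :: "nat \<Rightarrow> nat \<Rightarrow> real \<Rightarrow> (nat \<Rightarrow> nat \<Rightarrow> bit) pmf" where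
  "random_matrix m n q = Pi_pmf {..<m} (\<lambda>_. 0) (\<lambda>_. random_row n q)"

text \<open>The membership \<^prop>\<open>row_poly n (A i) \<in> polys_upto n d\<close> says that \<open>E\<close> is really
  defined on the \<open>i\<close>-th polynomial; without it the condition on its value would be void.\<close>

definition satisfies_system ::
    "nat \<Rightarrow> nat \<Rightarrow> nat \<Rightarrow> (nat \<Rightarrow> nat \<Rightarrow> bit) \<Rightarrow> (nat \<Rightarrow> bit) \<Rightarrow> (mpoly_real \<Rightarrow> real) \<Rightarrow> bool" where
  "satisfies_system m n d A b E \<longleftrightarrow>
     (\<forall>i<m. row_poly n (A i) \<in> polys_upto n d \<and>
            E (row_poly n (A i)) = (-1) ^ (of_bool (b i = 1) :: nat))"

end

theory Submission
  imports Defs "HOL-Real_Asymp.Real_Asymp"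
begin

text \<open>
  Let \<open>r\<close> be about \<open>1 / (4q)\<close>. A sum of \<open>k \<le> 2r - 2\<close> random rows has density at least \<open>qk/2\<close>, and
  a union bound shows that with high probability no nonempty sum of at most \<open>2r - 2\<close> rows vanishes,
  while single rows have weight at most \<open>d = n div 100\<close> and every sum of between \<open>r\<close> and \<open>2r - 2\<close> rows has weight larger than \<open>d\<close>.
  Hence a sum of two combinations of fewer than \<open>r\<close> rows whose weight is at most \<open>d\<close> is again a
  combination of fewer than \<open>r\<close> rows. The functional that maps a monomial to the sign forced by
  such a combination, if its odd part is one, and to \<open>0\<close> otherwise, is therefore well defined and
  multiplicative as long as the degree stays below \<open>d\<close>: its moment matrix is block diagonal with
  blocks of rank one, hence positive semidefinite.
\<close>

subsection \<open>Signs and sums of rows\<close>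

text \<open>The nontrivial additive character of the two-element field, with values in the reals so
  that it can be averaged.\<close>

definition bit_sign :: "bit \<Rightarrow> real" where
  "bit_sign x = (if x = 1 then -1 else 1)"

lemma bit_sign_simps [simp]: "bit_sign 0 = 1" "bit_sign 1 = -1"
  by (simp_all add: bit_sign_def)

lemma bit_sign_add: "bit_sign (x + y) = bit_sign x * bit_sign y"
  by (cases x; cases y) auto

text \<open>A vector over the two-element field is encoded as its support, so that addition becomes
  symmetric difference and Hamming weight becomes cardinality.\<close>

definition row_sum :: "nat \<Rightarrow> (nat \<Rightarrow> nat \<Rightarrow> bit) \<Rightarrow> nat set \<Rightarrow> nat set" where
  "row_sum n A I = {j. j < n \<and> (\<Sum>i\<in>I. A i j) = 1}"

lemma bit_sign_sum: "finite I \<Longrightarrow> bit_sign (\<Sum>i\<in>I. f i) = (\<Prod>i\<in>I. bit_sign (f i))"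
  by (induction I rule: finite_induct) (simp_all add: bit_sign_add del: add_bit_eq_xor)

lemma sum_sym_diff_bit:
  fixes f :: "'a \<Rightarrow> bit"
  assumes "finite I" "finite J"
  shows "sum f (sym_diff I J) = sum f I + sum f J"
proof -
  have "sum f I = sum f (I - J) + sum f (I \<inter> J)"
    using assms by (metis sum.Int_Diff add.commute)
  moreover have "sum f J = sum f (J - I) + sum f (I \<inter> J)"
    using assms by (metis sum.Int_Diff add.commute Int_commute)
  moreover have "sum f (sym_diff I J) = sum f (I - J) + sum f (J - I)"
    using assms by (intro sum.union_disjoint) auto
  ultimately show ?thesis by auto
qed

lemma row_sum_sym_diff:
  assumes "finite I" "finite J"
  shows "row_sum n A (sym_diff I J) = sym_diff (row_sum n A I) (row_sum n A J)"
  unfolding row_sum_def sum_sym_diff_bit[OF assms] by auto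

subsection \<open>Pseudo-expectations from small combinations\<close>

text \<open>By the hypotheses, \<open>K x y \<noteq> 0\<close> is an equivalence relation on
  \<open>X\<close>, and \<open>K\<close> is multiplicative along paths inside a class. Each class
  thus contributes the square of one linear form; averaging over the class avoids choosing a
  representative.\<close>

lemma kernel_nonneg:
  fixes K :: "'a \<Rightarrow> 'a \<Rightarrow> real" and c :: "'a \<Rightarrow> real"
  assumes "finite X"
    and K_refl: "\<And>x. x \<in> X \<Longrightarrow> K x x = 1"
    and K_sym: "\<And>x y. x \<in> X \<Longrightarrow> y \<in> X \<Longrightarrow> K x y = K y x"
    and K_trans: "\<And>x y z. x \<in> X \<Longrightarrow> y \<in> X \<Longrightarrow> z \<in> X \<Longrightarrow> K x y \<noteq> 0 \<Longrightarrow> K y z \<noteq> 0 \<Longrightarrow>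
       K x z = K x y * K y z"
  shows "0 \<le> (\<Sum>x\<in>X. \<Sum>y\<in>X. c x * c y * K x y)"
proof -
  \<comment> \<open>\<open>N x\<close> is the size of the equivalence class of
    \<open>x\<close>.\<close>
  define N where "N x = real (card {y \<in> X. K x y \<noteq> 0})" for x
  have N_pos: "N x > 0" if "x \<in> X" for x
  proof -
    have "x \<in> {y \<in> X. K x y \<noteq> 0}" using K_refl[OF that] that by simp
    moreover have "finite {y \<in> X. K x y \<noteq> 0}" using \<open>finite X\<close> by simp
    ultimately have "card {y \<in> X. K x y \<noteq> 0} > 0" unfolding card_gt_0_iff by blast
    then show ?thesis by (simp add: N_def)
  qed
  \<comment> \<open>The normalised kernel is idempotent, so the quadratic form is a sum of squares.\<close>
  have reproducing: "(\<Sum>z\<in>X. K x z * K z y / N z) = K x y" if xy: "x \<in> X" "y \<in> X" for x y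
  proof -
    have term_eq: "K x z * K z y / N z = (if K x z \<noteq> 0 then K x y / N x else 0)" if z: "z \<in> X" for z
    proof (cases "K x z = 0")
      case False
      have "{u \<in> X. K x u \<noteq> 0} = {u \<in> X. K z u \<noteq> 0}"
      proof (intro Collect_cong conj_cong)
        fix u assume u: "u \<in> X"
        show "K x u \<noteq> 0 \<longleftrightarrow> K z u \<noteq> 0"
          using K_trans[OF z xy(1) u] K_trans[OF xy(1) z u] K_sym[OF xy(1) z] False by force
      qed simp
      then have "N x = N z" by (simp add: N_def)
      moreover have "K x z * K z y = K x y"
      proof (cases "K z y = 0")
        case True
        \<comment> \<open>Otherwise \<open>z\<close>, \<open>x\<close> and \<open>y\<close> would
          lie in one class, on which the kernel does not vanish.\<close>
        have "K x y = 0"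
        proof (rule ccontr)
          assume "K x y \<noteq> 0"
          then have "K z y = K z x * K x y" using False xy z K_trans[of z x y] K_sym[of x z] by auto
          with True False \<open>K x y \<noteq> 0\<close> show False using K_sym[of x z] xy z by auto
        qed
        with True show ?thesis by simp
      next
        case nz: False
        show ?thesis using K_trans[OF xy(1) z xy(2) False nz] by simp
      qed
      ultimately show ?thesis using False by simp
    qed simp
    have "(\<Sum>z\<in>X. K x z * K z y / N z) = (\<Sum>z\<in>X. if K x z \<noteq> 0 then K x y / N x else 0)"
      by (intro sum.cong refl term_eq)
    also have "\<dots> = (\<Sum>z\<in>{z\<in>X. K x z \<noteq> 0}. K x y / N x)"
      using \<open>finite X\<close> by (rule sum.inter_filter[symmetric])
    also have "\<dots> = N x * (K x y / N x)" by (simp add: N_def)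
    also have "\<dots> = K x y" using N_pos[OF xy(1)] by simp
    finally show ?thesis .
  qed
  have "0 \<le> (\<Sum>z\<in>X. (\<Sum>x\<in>X. c x * K x z)\<^sup>2 / N z)"
    using N_pos by (intro sum_nonneg divide_nonneg_pos) auto
  also have "\<dots> = (\<Sum>z\<in>X. \<Sum>x\<in>X. \<Sum>y\<in>X. c x * c y * (K x z * K z y / N z))"
    unfolding power2_eq_square sum_product sum_divide_distrib
    by (intro sum.cong refl) (simp add: K_sym mult_ac)
  also have "\<dots> = (\<Sum>x\<in>X. \<Sum>y\<in>X. \<Sum>z\<in>X. c x * c y * (K x z * K z y / N z))"
    by (subst sum.swap) (intro sum.cong refl sum.swap)
  also have "\<dots> = (\<Sum>x\<in>X. \<Sum>y\<in>X. c x * c y * K x y)"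
    by (intro sum.cong refl) (simp only: sum_distrib_left[symmetric] reproducing)
  finally show ?thesis .
qed

text \<open>The variables that survive when a monomial is reduced modulo
  \<open>x_j^2 = 1\<close>.\<close>

definition odd_support :: "(nat \<Rightarrow>\<^sub>0 nat) \<Rightarrow> nat set" where
  "odd_support t = {j. odd (Poly_Mapping.lookup t j)}"

lemma odd_support_add: "odd_support (s + t) = sym_diff (odd_support s) (odd_support t)"
  by (auto simp: odd_support_def lookup_add)

lemma odd_support_subset_keys: "odd_support t \<subseteq> Poly_Mapping.keys t"
  by (auto simp: odd_support_def in_keys_iff intro!: odd_pos)

lemma finite_odd_support: "finite (odd_support t)"
  by (rule finite_subset[OF odd_support_subset_keys]) simp

lemma card_odd_support_le: "card (odd_support t) \<le> monom_degree t"
proof -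
  have "card (odd_support t) \<le> card (Poly_Mapping.keys t)"
    by (intro card_mono odd_support_subset_keys) simp
  also have "\<dots> \<le> monom_degree t" unfolding monom_degree_def card_eq_sum
    by (intro sum_mono) (auto simp: in_keys_iff)
  finally show ?thesis .
qed

section \<open>Linear functionals given by their values on monomials\<close>

definition lin_ext :: "('a \<Rightarrow> real) \<Rightarrow> ('a \<Rightarrow>\<^sub>0 real) \<Rightarrow> real" where
  "lin_ext w f = (\<Sum>t\<in>Poly_Mapping.keys f. Poly_Mapping.lookup f t * w t)"

lemma lin_ext_superset:
  assumes "finite X" "Poly_Mapping.keys f \<subseteq> X"
  shows "lin_ext w f = (\<Sum>t\<in>X. Poly_Mapping.lookup f t * w t)"
  unfolding lin_ext_def using assms by (intro sum.mono_neutral_left) (auto simp: in_keys_iff)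

lemma lin_ext_zero [simp]: "lin_ext w 0 = 0"
  by (simp add: lin_ext_def)

lemma lin_ext_add: "lin_ext w (f + g) = lin_ext w f + lin_ext w g"
proof -
  let ?X = "Poly_Mapping.keys f \<union> Poly_Mapping.keys g"
  have "lin_ext w (f + g) = (\<Sum>t\<in>?X. Poly_Mapping.lookup (f + g) t * w t)"
    by (intro lin_ext_superset) (auto simp: Poly_Mapping.keys_add)
  also have "\<dots> = lin_ext w f + lin_ext w g"
    by (simp add: lin_ext_superset[of ?X f] lin_ext_superset[of ?X g] lookup_add
        distrib_right sum.distrib)
  finally show ?thesis .
qed

lemma lin_ext_sum: "lin_ext w (\<Sum>i\<in>I. f i) = (\<Sum>i\<in>I. lin_ext w (f i))"
  by (induction I rule: infinite_finite_induct) (auto simp: lin_ext_add)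

lemma lin_ext_single [simp]: "lin_ext w (Poly_Mapping.single t c) = c * w t"
  by (simp add: lin_ext_def)

lemma poly_mapping_sum_single:
  "f = (\<Sum>t\<in>Poly_Mapping.keys f. Poly_Mapping.single t (Poly_Mapping.lookup f t))"
proof (rule poly_mapping_eqI)
  fix k show "Poly_Mapping.lookup f k =
    Poly_Mapping.lookup (\<Sum>t\<in>Poly_Mapping.keys f. Poly_Mapping.single t (Poly_Mapping.lookup f t)) k"
    by (simp add: lookup_sum lookup_single when_def in_keys_iff)
qed

text \<open>The sum runs over pairs of monomials, not over the keys of the product, where terms can
  merge or cancel. For \<open>f = g\<close> it is the quadratic form of the moment matrix with
  entries \<open>w (s + t)\<close>.\<close>

lemma lin_ext_mult:
  fixes f g :: "('a::monoid_add) \<Rightarrow>\<^sub>0 real"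
  shows "lin_ext w (f * g) = (\<Sum>s\<in>Poly_Mapping.keys f. \<Sum>t\<in>Poly_Mapping.keys g.
     Poly_Mapping.lookup f s * Poly_Mapping.lookup g t * w (s + t))"
proof -
  have "f * g = (\<Sum>s\<in>Poly_Mapping.keys f. \<Sum>t\<in>Poly_Mapping.keys g.
     Poly_Mapping.single (s + t) (Poly_Mapping.lookup f s * Poly_Mapping.lookup g t))"
    by (subst poly_mapping_sum_single[of f], subst poly_mapping_sum_single[of g])
       (simp add: sum_product mult_single)
  then show ?thesis by (simp add: lin_ext_sum)
qed

section \<open>Row polynomials as single monomials\<close>

lemma row_poly_eq_single:
  "row_poly n a = Poly_Mapping.single (\<Sum>j\<in>{j. j < n \<and> a j = 1}. Poly_Mapping.single j 1) 1"
proof -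
  have "(\<Prod>j\<in>S. mvar j) = Poly_Mapping.single (\<Sum>j\<in>S. Poly_Mapping.single j 1) 1"
    if "finite S" for S
    using that by (induction S rule: finite_induct) (auto simp: mvar_def mult_single)
  then show ?thesis by (simp add: row_poly_def)
qed

lemma lookup_sum_single_one:
  "finite S \<Longrightarrow> Poly_Mapping.lookup (\<Sum>j\<in>S. Poly_Mapping.single j (1::nat)) k = of_bool (k \<in> S)"
  by (simp add: lookup_sum lookup_single when_def)

lemma card_sym_diff_le: "finite I \<Longrightarrow> finite J \<Longrightarrow> card (sym_diff I J) \<le> card I + card J"
  by (rule order.trans[OF card_Un_le]) (intro add_mono card_mono; auto)

text \<open>The deterministic half, for a fixed matrix. The number \<open>2 * r - 2\<close> is the
  largest size of a symmetric difference of two sets with fewer than \<open>r\<close> elements.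
  Hence \<open>indep\<close> makes the small combination behind a given support unique, so no choice
  of \<open>b\<close> can force two different signs, and \<open>gap\<close> pushes a low-weight sum
  of two small combinations back below size \<open>r\<close>.\<close>

lemma exists_pseudo_expectation:
  fixes A :: "nat \<Rightarrow> nat \<Rightarrow> bit" and b :: "nat \<Rightarrow> bit" and n m d r :: nat
  assumes d: "2 \<le> d" and r: "2 \<le> r"
    and rows: "\<And>i. i < m \<Longrightarrow> card (row_sum n A {i}) \<le> d"
    and indep: "\<And>I. I \<subseteq> {..<m} \<Longrightarrow> I \<noteq> {} \<Longrightarrow> card I \<le> 2 * r - 2 \<Longrightarrow> row_sum n A I \<noteq> {}"
    and gap: "\<And>I. I \<subseteq> {..<m} \<Longrightarrow> r \<le> card I \<Longrightarrow> card I \<le> 2 * r - 2 \<Longrightarrow> d < card (row_sum n A I)"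
  shows "\<exists>E. pseudo_expectation n d E \<and> satisfies_system m n d A b E"
proof -
  define small where "small I \<longleftrightarrow> I \<subseteq> {..<m} \<and> card I < r" for I
  \<comment> \<open>The choice by \<open>SOME\<close> is harmless because \<open>unique\<close>
    below leaves one candidate. Supports without a small combination get the value 0.\<close>
  define e where "e S = (if \<exists>I. small I \<and> row_sum n A I = S
    then bit_sign (sum b (SOME I. small I \<and> row_sum n A I = S)) else 0)" for S
  define w where "w t = e (odd_support t)" for t
  have small_fin: "finite I" if "small I" for I
    using that finite_subset unfolding small_def by blast
  have small_diff: "sym_diff I J \<subseteq> {..<m}" "card (sym_diff I J) \<le> 2 * r - 2"
    if "small I" "small J" for I J
  proof -
    show "sym_diff I J \<subseteq> {..<m}" using that unfolding small_def by blast
    have "card (sym_diff I J) \<le> card I + card J"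
      using that small_fin by (intro card_sym_diff_le)
    then show "card (sym_diff I J) \<le> 2 * r - 2"
      using that unfolding small_def by linarith
  qed
  have unique: "I = J" if IJ: "small I" "small J" "row_sum n A I = row_sum n A J" for I J
  proof (rule ccontr)
    assume "I \<noteq> J"
    then have "sym_diff I J \<noteq> {}" by blast
    then have "row_sum n A (sym_diff I J) \<noteq> {}"
      using indep small_diff[OF IJ(1,2)] by blast
    then show False
      using IJ row_sum_sym_diff[OF small_fin small_fin] by simp
  qed
  have e_row: "e (row_sum n A I) = bit_sign (sum b I)" if "small I" for I
  proof -
    have "(SOME J. small J \<and> row_sum n A J = row_sum n A I) = I"
      using that unique by (intro some_equality) auto
    with that show ?thesis unfolding e_def by auto
  qed
  have e_mult: "e (sym_diff S T) = e S * e T"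
    if "e S \<noteq> 0" "e T \<noteq> 0" and le: "card (sym_diff S T) \<le> d" for S T
  proof -
    obtain I J where I: "small I" "S = row_sum n A I" and J: "small J" "T = row_sum n A J"
      using \<open>e S \<noteq> 0\<close> \<open>e T \<noteq> 0\<close> unfolding e_def by metis
    note fin = small_fin[OF I(1)] small_fin[OF J(1)]
    have ST: "sym_diff S T = row_sum n A (sym_diff I J)"
      using I J row_sum_sym_diff[OF fin] by simp
    \<comment> \<open>Sizes from \<open>r\<close> to \<open>2 * r - 2\<close> are excluded, as
      \<open>gap\<close> would make the weight exceed \<open>d\<close>.\<close>
    have "card (sym_diff I J) < r"
      using gap[OF small_diff(1)[OF I(1) J(1)] _ small_diff(2)[OF I(1) J(1)]] le
      unfolding ST by linarith
    then have "small (sym_diff I J)"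
      using small_diff(1)[OF I(1) J(1)] by (simp add: small_def)
    then have "e (sym_diff S T) = bit_sign (sum b I + sum b J)"
      unfolding ST by (simp only: e_row sum_sym_diff_bit[OF fin])
    then show ?thesis
      unfolding bit_sign_add I(2) J(2) e_row[OF I(1)] e_row[OF J(1)] .
  qed
  have e_empty: "e {} = 1"
  proof -
    have "small {}" using r by (simp add: small_def)
    from e_row[OF this] show ?thesis by (simp add: row_sum_def)
  qed
  have pseudo: "pseudo_expectation n d (lin_ext w)"
    unfolding pseudo_expectation_def
  proof (intro conjI ballI allI impI)
    show "2 \<le> d" by fact
    show "lin_ext w (f + g) = lin_ext w f + lin_ext w g" for f g by (rule lin_ext_add)
    show "lin_ext w (mconst c * f) = c * lin_ext w f" for c f
      \<comment> \<open>The key set of \<open>mconst c\<close> is \<open>{0}\<close> only for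
        nonzero \<open>c\<close>, hence the case split before the product is expanded.\<close>
      by (cases "c = 0", simp add: mconst_def, simp add: lin_ext_mult mconst_def)
        (simp add: lin_ext_def sum_distrib_left mult.assoc)
    have "odd_support 0 = {}" by (simp add: odd_support_def)
    then have "w 0 = 1" by (simp add: w_def e_empty)
    then show "lin_ext w 1 = 1" by (simp flip: single_one)
    show "lin_ext w (f * mvar i ^ 2) = lin_ext w f" for f i
    proof -
      \<comment> \<open>Multiplying by a square changes no parity, so \<open>w\<close> cannot see
        it.\<close>
      have "odd_support (s + Poly_Mapping.single i 2) = odd_support s" for s
        by (auto simp: odd_support_def lookup_add lookup_single when_def)
      moreover have "mvar i ^ 2 = Poly_Mapping.single (Poly_Mapping.single i 2) 1"
        by (simp add: mvar_def power2_eq_square mult_single numeral_2_eq_2 flip: single_add)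
      ultimately show ?thesis by (simp add: lin_ext_mult w_def) (simp add: lin_ext_def w_def)
    qed
    show "0 \<le> lin_ext w (f ^ 2)" if f: "f \<in> polys_upto n (d div 2)" for f
    proof -
      let ?X = "Poly_Mapping.keys f"
      have le: "card (sym_diff (odd_support s) (odd_support t)) \<le> d"
        if "s \<in> ?X" "t \<in> ?X" for s t
      proof -
        have "card (odd_support u) \<le> d div 2" if "u \<in> ?X" for u
          using f that card_odd_support_le[of u] unfolding polys_upto_def by force
        from this[OF that(1)] this[OF that(2)] show ?thesis
          using card_sym_diff_le[OF finite_odd_support finite_odd_support, of s t] by linarith
      qed
      have "0 \<le> (\<Sum>s\<in>?X. \<Sum>t\<in>?X. Poly_Mapping.lookup f s * Poly_Mapping.lookup f t * w (s + t))"
      proof (rule kernel_nonneg)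
        show "w (s + s) = 1" for s by (simp add: w_def odd_support_add e_empty)
        show "w (s + t) = w (t + s)" for s t by (simp add: add.commute)
        fix s t u assume X: "s \<in> ?X" "t \<in> ?X" "u \<in> ?X" and nz: "w (s + t) \<noteq> 0" "w (t + u) \<noteq> 0"
        \<comment> \<open>The middle monomial \<open>t\<close> cancels, so the weight that
          \<open>e_mult\<close> has to control is that of \<open>s + u\<close>, at most
          \<open>d\<close> since both degrees are at most \<open>d div 2\<close>.\<close>
        have "sym_diff (sym_diff (odd_support s) (odd_support t))
            (sym_diff (odd_support t) (odd_support u)) = sym_diff (odd_support s) (odd_support u)"
          by auto
        with e_mult[of "odd_support (s + t)" "odd_support (t + u)"] nz le[OF X(1,3)]
        show "w (s + u) = w (s + t) * w (t + u)"
          by (simp add: w_def odd_support_add)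
      qed simp
      then show ?thesis by (simp add: power2_eq_square lin_ext_mult)
    qed
  qed
  have "satisfies_system m n d A b (lin_ext w)"
    unfolding satisfies_system_def
  proof (intro allI impI conjI)
    fix i assume i: "i < m"
    define S where "S = {j. j < n \<and> A i j = 1}"
    define t where "t = (\<Sum>j\<in>S. Poly_Mapping.single j (1::nat))"
    have S: "finite S" "row_sum n A {i} = S" by (auto simp: S_def row_sum_def)
    have poly: "row_poly n (A i) = Poly_Mapping.single t 1"
      by (simp add: row_poly_eq_single t_def S_def)
    have lookup: "Poly_Mapping.lookup t k = of_bool (k \<in> S)" for k
      unfolding t_def by (rule lookup_sum_single_one[OF S(1)])
    have keys: "Poly_Mapping.keys t = S" by (auto simp: in_keys_iff lookup)
    have "monom_degree t \<le> d"
      using rows[OF i] by (simp add: monom_degree_def keys lookup S)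
    then show "row_poly n (A i) \<in> polys_upto n d"
      by (auto simp: poly polys_upto_def keys S_def)
    have "small {i}" using i r by (simp add: small_def)
    moreover have "odd_support t = row_sum n A {i}"
      by (auto simp: odd_support_def lookup S)
    ultimately show "lin_ext w (row_poly n (A i)) = (-1) ^ (of_bool (b i = 1) :: nat)"
      by (simp add: poly w_def e_row bit_sign_def)
  qed
  with pseudo show ?thesis by blast
qed

subsection \<open>Weights of random row sums\<close>

lemma finite_set_Pi_pmf:
  assumes "finite A" "\<And>x. x \<in> A \<Longrightarrow> finite (set_pmf (p x))"
  shows "finite (set_pmf (Pi_pmf A dflt p))"
  using assms by (auto simp: set_Pi_pmf)

lemma expectation_prod_subset_Pi_pmf:
  fixes g :: "'b \<Rightarrow> real"
  assumes A: "finite A" and I: "I \<subseteq> A" and p: "finite (set_pmf p)"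
  shows "measure_pmf.expectation (Pi_pmf A dflt (\<lambda>_. p)) (\<lambda>y. \<Prod>i\<in>I. g (y i))
    = measure_pmf.expectation p g ^ card I"
proof -
  let ?P = "Pi_pmf A dflt (\<lambda>_. p)"
  have int: "integrable (measure_pmf ?P) h" for h :: "_ \<Rightarrow> real"
    using finite_set_Pi_pmf[OF A, of "\<lambda>_. p"] p by (intro integrable_measure_pmf_finite)
  have "prob_space.indep_vars (measure_pmf ?P) (\<lambda>_. count_space UNIV) (\<lambda>x f. f x) I"
    by (rule prob_space.indep_vars_subset[OF measure_pmf.prob_space_axioms indep_vars_Pi_pmf[OF A] I])
  then have "prob_space.indep_vars (measure_pmf ?P) (\<lambda>_. borel) (\<lambda>i y. g (y i)) I"
    by (rule prob_space.indep_vars_compose2[OF measure_pmf.prob_space_axioms,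
          where X = "\<lambda>x f. f x" and Y = "\<lambda>_. g"]) auto
  then have "measure_pmf.expectation ?P (\<lambda>y. \<Prod>i\<in>I. g (y i))
      = (\<Prod>i\<in>I. measure_pmf.expectation ?P (\<lambda>y. g (y i)))"
    using A I finite_subset int
    by (intro prob_space.indep_vars_lebesgue_integral[OF measure_pmf.prob_space_axioms]) blast+
  also have "\<dots> = (\<Prod>i\<in>I. measure_pmf.expectation p g)"
  proof (rule prod.cong[OF refl])
    fix i assume "i \<in> I"
    then have "map_pmf (\<lambda>y. y i) ?P = p"
      using I by (subst Pi_pmf_component[OF A]) auto
    then show "measure_pmf.expectation ?P (\<lambda>y. g (y i)) = measure_pmf.expectation p g"
      using integral_map_pmf[of "\<lambda>y. y i" ?P g] by simp
  qed
  finally show ?thesis by simp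
qed

lemma finite_set_random_row: "finite (set_pmf (random_row n q))"
  unfolding random_row_def by (intro finite_set_Pi_pmf) auto

lemma finite_set_random_matrix: "finite (set_pmf (random_matrix m n q))"
  unfolding random_matrix_def by (intro finite_set_Pi_pmf finite_set_random_row) auto

text \<open>Independence is used twice, first across rows and then across the entries of a row.
  Later \<open>h\<close> is a character, with mean \<open>1 - 2 * q\<close>, or the generating
  function \<open>2 ^ x\<close> of an entry, with mean \<open>1 + q\<close>.\<close>

lemma expectation_random_matrix_prod:
  fixes h :: "bit \<Rightarrow> real"
  assumes "I \<subseteq> {..<m}" "T \<subseteq> {..<n}" "0 \<le> q" "q \<le> 1"
  shows "measure_pmf.expectation (random_matrix m n q) (\<lambda>A. \<Prod>i\<in>I. \<Prod>j\<in>T. h (A i j))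
    = (q * h 1 + (1 - q) * h 0) ^ (card T * card I)"
proof -
  have "measure_pmf.expectation (map_pmf of_bool (bernoulli_pmf q)) h = q * h 1 + (1 - q) * h 0"
    using assms(3,4) by simp
  then show ?thesis
    unfolding random_matrix_def
    by (subst expectation_prod_subset_Pi_pmf[OF _ assms(1) finite_set_random_row])
       (auto simp: random_row_def expectation_prod_subset_Pi_pmf[OF _ assms(2)] power_mult)
qed

text \<open>The sign of column \<open>j\<close> is -1 exactly when \<open>j\<close> is in the
  support of the sum, so its factor is \<open>-1/4 + 3/4 = 1/2\<close> there and 1
  elsewhere.\<close>

lemma half_power_card_row_sum:
  assumes "finite I"
  shows "(1 / 2 :: real) ^ card (row_sum n A I) = (\<Prod>j<n. (\<Prod>i\<in>I. bit_sign (A i j)) / 4 + 3 / 4)"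
proof -
  have "(\<Prod>j<n. (\<Prod>i\<in>I. bit_sign (A i j)) / 4 + 3 / 4)
      = (\<Prod>j<n. if (\<Sum>i\<in>I. A i j) = 1 then 1 / 2 else (1::real))"
    by (intro prod.cong refl) (simp only: bit_sign_sum[OF assms, symmetric], auto simp: bit_sign_def)
  also have "\<dots> = (\<Prod>j\<in>row_sum n A I. 1 / 2)"
    unfolding row_sum_def by (subst prod.inter_filter[symmetric]) (auto intro: prod.cong)
  finally show ?thesis by simp
qed

text \<open>With \<open>k = card I\<close>, a column of the sum equals 1 with probability
  \<open>(1 - (1 - 2 * q) ^ k) / 2\<close>. The right-hand side is the generating function at 1/2 of
  a binomial weight with this parameter.\<close>

lemma expectation_half_power_card_row_sum:
  assumes I: "I \<subseteq> {..<m}" and q: "0 \<le> q" "q \<le> 1"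
  shows "measure_pmf.expectation (random_matrix m n q) (\<lambda>A. (1 / 2) ^ card (row_sum n A I))
    = ((1 - 2 * q) ^ card I / 4 + 3 / 4) ^ n"
proof -
  have fin: "finite I" using I finite_subset by blast
  let ?M = "random_matrix m n q"
  have int: "integrable (measure_pmf ?M) h" for h :: "_ \<Rightarrow> real"
    by (intro integrable_measure_pmf_finite finite_set_random_matrix)
  \<comment> \<open>The matrix is independent by rows, while the weight is a product over columns: expanding that
    product into characters separates the rows.\<close>
  have "measure_pmf.expectation ?M (\<lambda>A. (1 / 2) ^ card (row_sum n A I))
      = measure_pmf.expectation ?M (\<lambda>A. \<Sum>T\<in>Pow {..<n}.
          (\<Prod>i\<in>I. \<Prod>j\<in>T. bit_sign (A i j)) * ((1 / 4) ^ card T * (3 / 4) ^ card ({..<n} - T)))"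
  proof (intro Bochner_Integration.integral_cong refl)
    fix A :: "nat \<Rightarrow> nat \<Rightarrow> bit"
    have "(1 / 2 :: real) ^ card (row_sum n A I) = (\<Sum>T\<in>Pow {..<n}.
        (\<Prod>j\<in>T. (\<Prod>i\<in>I. bit_sign (A i j)) / 4) * (\<Prod>j\<in>{..<n} - T. 3 / 4))"
      unfolding half_power_card_row_sum[OF fin] by (rule prod_add) simp
    also have "\<dots> = (\<Sum>T\<in>Pow {..<n}.
          (\<Prod>i\<in>I. \<Prod>j\<in>T. bit_sign (A i j)) * ((1 / 4) ^ card T * (3 / 4) ^ card ({..<n} - T)))"
    proof (rule sum.cong[OF refl])
      fix T
      have "(\<Prod>j\<in>T. (\<Prod>i\<in>I. bit_sign (A i j)) / 4) = (\<Prod>i\<in>I. \<Prod>j\<in>T. bit_sign (A i j)) * (1 / 4) ^ card T"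
        by (subst prod.swap) (simp add: prod_dividef power_one_over)
      then show "(\<Prod>j\<in>T. (\<Prod>i\<in>I. bit_sign (A i j)) / 4) * (\<Prod>j\<in>{..<n} - T. 3 / 4)
        = (\<Prod>i\<in>I. \<Prod>j\<in>T. bit_sign (A i j)) * ((1 / 4) ^ card T * (3 / 4) ^ card ({..<n} - T))"
        by simp
    qed
    finally show "(1 / 2 :: real) ^ card (row_sum n A I) = (\<Sum>T\<in>Pow {..<n}.
          (\<Prod>i\<in>I. \<Prod>j\<in>T. bit_sign (A i j)) * ((1 / 4) ^ card T * (3 / 4) ^ card ({..<n} - T)))" .
  qed
  also have "\<dots> = (\<Sum>T\<in>Pow {..<n}.
      (1 - 2 * q) ^ (card T * card I) * ((1 / 4) ^ card T * (3 / 4) ^ card ({..<n} - T)))"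
  proof -
    have "measure_pmf.expectation ?M (\<lambda>A. \<Prod>i\<in>I. \<Prod>j\<in>T. bit_sign (A i j)) = (1 - 2 * q) ^ (card T * card I)"
      if "T \<subseteq> {..<n}" for T
      using expectation_random_matrix_prod[OF I that q, of bit_sign] by simp
    then show ?thesis
      by (subst Bochner_Integration.integral_sum[OF int]) (auto intro!: sum.cong)
  qed
  \<comment> \<open>The exponent is linear in \<open>card T\<close>, so the sum is again the
    expansion of a product over columns, now with \<open>n\<close> equal factors.\<close>
  also have "\<dots> = (\<Sum>T\<in>Pow {..<n}. (\<Prod>j\<in>T. (1 - 2 * q) ^ card I / 4) * (\<Prod>j\<in>{..<n} - T. 3 / 4))"
    by (intro sum.cong refl) (simp add: power_mult mult.commute[of "card _" "card I"] power_divide)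
  also have "\<dots> = ((1 - 2 * q) ^ card I / 4 + 3 / 4) ^ n"
    by (subst prod_add[symmetric]) auto
  finally show ?thesis .
qed

text \<open>Markov's inequality for 1/2 to the power of the weight. The condition
  \<open>2 * q * card I \<le> 1\<close> keeps the density of the sum in the range where it grows
  linearly in \<open>card I\<close>.\<close>

lemma prob_card_row_sum_le:
  fixes q :: real
  assumes I: "I \<subseteq> {..<m}" and q: "0 \<le> q" and k: "2 * q * card I \<le> 1" "I \<noteq> {}"
  shows "measure_pmf.prob (random_matrix m n q) {A. card (row_sum n A I) \<le> D}
    \<le> 2 ^ D * exp (- (q * card I * n / 4))"
proof -
  let ?M = "random_matrix m n q"
  let ?k = "card I"
  have "?k \<ge> 1" using I k(2) finite_subset[OF I] by (simp add: Suc_le_eq card_gt_0_iff)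
  then have "2 * q \<le> 2 * q * ?k" using q by (simp add: mult_le_cancel_left1)
  then have q1: "2 * q \<le> 1" using k by linarith
  have int: "integrable (measure_pmf ?M) h" for h :: "_ \<Rightarrow> real"
    by (intro integrable_measure_pmf_finite finite_set_random_matrix)
  have "measure_pmf.prob ?M {A. card (row_sum n A I) \<le> D}
      = measure_pmf.prob ?M {A\<in>space ?M. (1 / 2 :: real) ^ D \<le> (1 / 2) ^ card (row_sum n A I)}"
    by (intro arg_cong[of _ _ "measure_pmf.prob ?M"]) auto
  also have "\<dots> \<le> measure_pmf.expectation ?M (\<lambda>A. (1 / 2) ^ card (row_sum n A I)) / (1 / 2) ^ D"
    by (rule integral_Markov_inequality_measure[OF int]) auto
  also have "\<dots> = 2 ^ D * ((1 - 2 * q) ^ ?k / 4 + 3 / 4) ^ n"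
    using q q1 by (subst expectation_half_power_card_row_sum[OF I]) (auto simp: power_one_over)
  also have "\<dots> \<le> 2 ^ D * exp (- (q * ?k / 4)) ^ n"
  proof (intro mult_left_mono power_mono)
    have "(1 - 2 * q) ^ ?k \<le> exp (- (2 * q)) ^ ?k"
      using q1 exp_ge_add_one_self[of "- (2 * q)"] by (intro power_mono) auto
    also have "\<dots> = exp (- (2 * q * ?k))" by (simp add: exp_of_nat_mult[symmetric] mult_ac)
    also have "\<dots> \<le> 1 - q * ?k"
    proof -
      \<comment> \<open>For \<open>0 \<le> x \<le> 1\<close> one has
        \<open>exp (- x) \<le> 1 - x / 2\<close>; this is where the bound on
        \<open>2 * q * card I\<close> enters.\<close>
      define x where "x = 2 * q * real ?k"
      have x: "0 \<le> x" "x \<le> 1" using q k by (auto simp: x_def)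
      have "exp (- x) \<le> 1 / (1 + x)"
        using exp_ge_add_one_self[of x] x by (simp add: exp_minus divide_simps)
      also have "\<dots> \<le> 1 - x / 2" using x mult_left_mono[of x 1 x] by (simp add: field_simps)
      finally show ?thesis by (simp add: x_def)
    qed
    finally have "(1 - 2 * q) ^ ?k / 4 + 3 / 4 \<le> 1 + (- (q * ?k / 4))" by simp
    also have "\<dots> \<le> exp (- (q * ?k / 4))" by (rule exp_ge_add_one_self)
    finally show "(1 - 2 * q) ^ ?k / 4 + 3 / 4 \<le> exp (- (q * ?k / 4))" .
    show "0 \<le> (1 - 2 * q) ^ ?k / 4 + 3 / 4" using q1 by simp
  qed auto
  also have "exp (- (q * ?k / 4)) ^ n = exp (- (q * ?k * n / 4))"
    by (simp add: exp_of_nat_mult[symmetric] mult_ac)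
  finally show ?thesis .
qed

text \<open>Markov's inequality for 2 to the power of the weight, whose mean is
  \<open>(1 + q) ^ n\<close>.\<close>

lemma prob_card_row_ge:
  fixes q :: real
  assumes i: "i < m" and q: "0 \<le> q" "q \<le> 1"
  shows "measure_pmf.prob (random_matrix m n q) {A. d \<le> card (row_sum n A {i})}
    \<le> exp (q * n) / 2 ^ d"
proof -
  let ?M = "random_matrix m n q"
  have int: "integrable (measure_pmf ?M) h" for h :: "_ \<Rightarrow> real"
    by (intro integrable_measure_pmf_finite finite_set_random_matrix)
  have two: "(2::real) ^ card (row_sum n A {i}) = (\<Prod>k\<in>{i}. \<Prod>j<n. if A k j = 1 then 2 else 1)" for A
  proof -
    have "(\<Prod>j<n. if A i j = 1 then 2 else 1) = (\<Prod>j\<in>row_sum n A {i}. 2::real)"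
      unfolding row_sum_def by (subst prod.inter_filter[symmetric]) (auto intro: prod.cong)
    then show ?thesis by simp
  qed
  have "measure_pmf.prob ?M {A. d \<le> card (row_sum n A {i})}
      = measure_pmf.prob ?M {A\<in>space ?M. (2 :: real) ^ d \<le> 2 ^ card (row_sum n A {i})}"
    by (intro arg_cong[of _ _ "measure_pmf.prob ?M"]) auto
  also have "\<dots> \<le> measure_pmf.expectation ?M (\<lambda>A. 2 ^ card (row_sum n A {i})) / 2 ^ d"
    by (rule integral_Markov_inequality_measure[OF int]) auto
  also have "measure_pmf.expectation ?M (\<lambda>A. 2 ^ card (row_sum n A {i})) = (1 + q) ^ n"
    unfolding two using i q by (subst expectation_random_matrix_prod) (auto simp: add.commute)
  also have "(1 + q) ^ n \<le> exp q ^ n" using q by (intro power_mono) auto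
  also have "\<dots> = exp (q * n)" by (simp add: exp_of_nat_mult[symmetric] mult_ac)
  finally show ?thesis by (simp add: divide_right_mono)
qed

text \<open>Union bound over at most \<open>m ^ k\<close> index sets. The single-set estimate is,
  apart from \<open>2 ^ D\<close>, also a \<open>k\<close>-th power, so everything hinges on the
  base \<open>m * exp (- (q * n / 4))\<close>.\<close>

lemma prob_exists_card_row_sum_le:
  fixes q :: real
  assumes q: "0 \<le> q" and k: "1 \<le> k" "2 * q * k \<le> 1"
  shows "measure_pmf.prob (random_matrix m n q)
      {A. \<exists>I\<subseteq>{..<m}. card I = k \<and> card (row_sum n A I) \<le> D}
    \<le> 2 ^ D * (m * exp (- (q * n / 4))) ^ k"
proof -
  let ?M = "random_matrix m n q"
  let ?S = "{I. I \<subseteq> {..<m} \<and> card I = k}"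
  have "{A. \<exists>I\<subseteq>{..<m}. card I = k \<and> card (row_sum n A I) \<le> D}
      = (\<Union>I\<in>?S. {A. card (row_sum n A I) \<le> D})" by auto
  then have "measure_pmf.prob ?M {A. \<exists>I\<subseteq>{..<m}. card I = k \<and> card (row_sum n A I) \<le> D}
      \<le> (\<Sum>I\<in>?S. measure_pmf.prob ?M {A. card (row_sum n A I) \<le> D})"
    by (simp only:) (intro measure_pmf.finite_measure_subadditive_finite; auto)
  also have "\<dots> \<le> (\<Sum>I\<in>?S. 2 ^ D * exp (- (q * k * n / 4)))"
  proof (intro sum_mono)
    fix I assume "I \<in> ?S"
    then show "measure_pmf.prob ?M {A. card (row_sum n A I) \<le> D} \<le> 2 ^ D * exp (- (q * k * n / 4))"
      using prob_card_row_sum_le[of I m q n D] q k by fastforce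
  qed
  also have "\<dots> = real (m choose k) * (2 ^ D * exp (- (q * k * n / 4)))"
    by (simp add: n_subsets)
  also have "\<dots> \<le> real m ^ k * (2 ^ D * exp (- (q * k * n / 4)))"
  proof (intro mult_right_mono)
    have "m choose k \<le> m ^ k"
      by (cases "k \<le> m") (auto simp: binomial_le_pow binomial_eq_0)
    then show "real (m choose k) \<le> real m ^ k" by (metis of_nat_mono of_nat_power)
  qed simp
  also have "exp (- (q * k * n / 4)) = exp (- (q * n / 4)) ^ k"
    by (simp add: exp_of_nat_mult[symmetric] mult_ac)
  finally show ?thesis by (simp add: power_mult_distrib mult_ac)
qed

text \<open>The three summands bound heavy single rows (\<open>R\<close>), vanishing short sums
  (\<open>F\<close>) and light sums of at least \<open>r\<close> rows (\<open>G\<close>). The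
  parameter \<open>x\<close> bounds the union-bound base from above, which suffices for
  \<open>F\<close>; for \<open>G\<close> the decay in \<open>n\<close> must survive, which the
  second bound \<open>m\<close> on the base provides.\<close>

lemma prob_not_satisfiable_le:
  fixes q x :: real and m n d r K :: nat
  defines "K \<equiv> 2 * r - 2"
  assumes q: "0 < q" and d: "2 \<le> d" and r: "2 \<le> r" and K: "2 * q * K \<le> 1" and qr: "1 / 4 \<le> q * r"
    and x: "m * exp (- (q * n / 4)) \<le> x" "x \<le> 1"
    and m: "m * exp (- (q * n / 4)) \<le> 2 * exp (- (q * n / 8))"
  shows "measure_pmf.prob (random_matrix m n q)
      {A. \<not> (\<forall>b. \<exists>E. pseudo_expectation n d E \<and> satisfies_system m n d A b E)}
    \<le> m * exp (q * n) / 2 ^ d + K * x + real K * 2 ^ d * 2 ^ K * exp (- (n / 32))"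
proof -
  let ?M = "random_matrix m n q"
  let ?y = "m * exp (- (q * n / 4))"
  define R where "R = (\<Union>i<m. {A. d \<le> card (row_sum n A {i})})"
  define S where "S D k = {A. \<exists>I\<subseteq>{..<m}. card I = k \<and> card (row_sum n A I) \<le> D}" for D k
  define F where "F = (\<Union>k\<in>{1..K}. S 0 k)"
  define G where "G = (\<Union>k\<in>{r..K}. S d k)"
  have kq: "2 * q * k \<le> 1" if "k \<le> K" for k :: nat
  proof -
    have "2 * q * k \<le> 2 * q * K" using q that by (intro mult_left_mono) auto
    with K show ?thesis by linarith
  qed
  have "{A. \<not> (\<forall>b. \<exists>E. pseudo_expectation n d E \<and> satisfies_system m n d A b E)} \<subseteq> R \<union> F \<union> G"
  proof (rule subsetI, rule ccontr)
    fix A assume A: "A \<in> {A. \<not> (\<forall>b. \<exists>E. pseudo_expectation n d E \<and> satisfies_system m n d A b E)}"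
      and good: "A \<notin> R \<union> F \<union> G"
    have "\<exists>E. pseudo_expectation n d E \<and> satisfies_system m n d A b E" for b
    proof (rule exists_pseudo_expectation[OF d r])
      show "card (row_sum n A {i}) \<le> d" if "i < m" for i
      proof -
        have "A \<notin> {A. d \<le> card (row_sum n A {i})}"
          using good that unfolding R_def by blast
        then show ?thesis by simp
      qed
      show "row_sum n A I \<noteq> {}" if I: "I \<subseteq> {..<m}" "I \<noteq> {}" "card I \<le> 2 * r - 2" for I
      proof
        assume "row_sum n A I = {}"
        then have "A \<in> S 0 (card I)"
          unfolding S_def using I(1) by (intro CollectI exI[of _ I]) simp
        moreover have "card I \<ge> 1" using I finite_subset[of I "{..<m}"] by (simp add: Suc_le_eq card_gt_0_iff)
        ultimately have "A \<in> F"
          unfolding F_def using I(3) by (intro UN_I[of "card I"]) (simp_all add: K_def)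
        with good show False by blast
      qed
      show "d < card (row_sum n A I)"
        if I: "I \<subseteq> {..<m}" "r \<le> card I" "card I \<le> 2 * r - 2" for I
      proof (rule ccontr)
        assume "\<not> d < card (row_sum n A I)"
        then have "A \<in> S d (card I)"
          unfolding S_def using I(1) by (intro CollectI exI[of _ I]) simp
        then have "A \<in> G"
          unfolding G_def using I(2,3) by (intro UN_I[of "card I"]) (simp_all add: K_def)
        with good show False by blast
      qed
    qed
    with A show False by blast
  qed
  then have "measure_pmf.prob ?M {A. \<not> (\<forall>b. \<exists>E. pseudo_expectation n d E \<and> satisfies_system m n d A b E)}
      \<le> measure_pmf.prob ?M (R \<union> F \<union> G)"
    by (intro measure_pmf.finite_measure_mono) auto
  also have "\<dots> \<le> measure_pmf.prob ?M R + measure_pmf.prob ?M F + measure_pmf.prob ?M G"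
    using measure_Un_le[of "R \<union> F" ?M G]
      measure_Un_le[of R ?M F] by simp
  also have "measure_pmf.prob ?M R \<le> m * exp (q * n) / 2 ^ d"
  proof -
    have "2 * q * 1 \<le> 1" using kq[of 1] r by (simp add: K_def)
    then have "q \<le> 1" using q by linarith
    have "measure_pmf.prob ?M R \<le> (\<Sum>i<m. measure_pmf.prob ?M {A. d \<le> card (row_sum n A {i})})"
      unfolding R_def by (intro measure_pmf.finite_measure_subadditive_finite) auto
    also have "\<dots> \<le> (\<Sum>i<m. exp (q * n) / 2 ^ d)"
      using q \<open>q \<le> 1\<close> by (intro sum_mono prob_card_row_ge) auto
    finally show ?thesis by simp
  qed
  also have "measure_pmf.prob ?M F \<le> K * x"
  proof -
    have "measure_pmf.prob ?M F \<le> (\<Sum>k\<in>{1..K}. measure_pmf.prob ?M (S 0 k))"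
      unfolding F_def by (intro measure_pmf.finite_measure_subadditive_finite) auto
    also have "\<dots> \<le> (\<Sum>k\<in>{1..K}. x)"
    proof (intro sum_mono)
      fix k assume k: "k \<in> {1..K}"
      have "measure_pmf.prob ?M (S 0 k) \<le> ?y ^ k"
        using prob_exists_card_row_sum_le[of q k m n 0] k kq[of k] q by (simp add: S_def)
      \<comment> \<open>The base is at most 1, so \<open>k = 1\<close> is the worst case.\<close>
      also have "\<dots> \<le> ?y ^ 1" using k x by (intro power_decreasing) auto
      finally show "measure_pmf.prob ?M (S 0 k) \<le> x" using x by simp
    qed
    finally show ?thesis by simp
  qed
  also have "measure_pmf.prob ?M G \<le> real K * 2 ^ d * 2 ^ K * exp (- (n / 32))"
  proof -
    let ?b = "2 ^ d * (2 ^ K * exp (- (n / 32))) :: real"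
    have "measure_pmf.prob ?M G \<le> (\<Sum>k\<in>{r..K}. measure_pmf.prob ?M (S d k))"
      unfolding G_def by (intro measure_pmf.finite_measure_subadditive_finite) auto
    also have "\<dots> \<le> (\<Sum>k\<in>{r..K}. ?b)"
    proof (intro sum_mono)
      fix k assume k: "k \<in> {r..K}"
      have "measure_pmf.prob ?M (S d k) \<le> 2 ^ d * ?y ^ k"
        using prob_exists_card_row_sum_le[of q k m n d] k kq[of k] q r by (simp add: S_def)
      \<comment> \<open>Half of the exponent pays for \<open>m\<close>. The other half, raised to
        the power \<open>k \<ge> r\<close> with \<open>q * r \<ge> 1 / 4\<close>, leaves
        \<open>exp (- (n / 32))\<close>, enough to beat \<open>2 ^ d\<close>.\<close>
      also have "?y ^ k \<le> 2 ^ k * exp (- (q * n / 8)) ^ k"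
        unfolding power_mult_distrib[symmetric] using m by (intro power_mono) auto
      also have "exp (- (q * n / 8)) ^ k = exp (- (q * k * n / 8))"
        by (simp add: exp_of_nat_mult[symmetric] mult_ac)
      also have "\<dots> \<le> exp (- (n / 32))"
      proof -
        have "q * r \<le> q * k" using k q by (intro mult_left_mono) auto
        with qr have "1 / 4 \<le> q * k" by linarith
        then have "1 / 4 * real n \<le> q * k * n" by (intro mult_right_mono) auto
        then show ?thesis by simp
      qed
      also have "(2::real) ^ k \<le> 2 ^ K" using k by (intro power_increasing) auto
      finally show "measure_pmf.prob ?M (S d k) \<le> ?b" by simp
    qed
    also have "\<dots> = real (card {r..K}) * ?b" by simp
    also have "\<dots> \<le> K * ?b" using r by (intro mult_right_mono) auto
    finally show ?thesis by (simp add: mult_ac)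
  qed
  finally show ?thesis by simp
qed

subsection \<open>Asymptotics\<close>

text \<open>Here \<open>u n\<close> is sublinear but outgrows the logarithm of \<open>B n\<close>,
  and \<open>exp (B n)\<close> is only a power of \<open>n\<close>. The linear exponents compare as
  \<open>1/400 < 1/200\<close> and \<open>1/100 < 1/32\<close>.\<close>

lemma failure_bound_tendsto_0:
  fixes c :: real
  assumes "c > 0"
  defines "u \<equiv> \<lambda>n::nat. c * real n / ln (real n)"
    and "B \<equiv> \<lambda>n::nat. ln (real n) / (16 * c)"
  shows "(\<lambda>n. 4 * exp (u n) * exp (n / 400) * exp (- (n / 200)) + B n * (2 * exp (- u n))
    + B n * exp (n / 100) * exp (B n) * exp (- (n / 32))) \<longlonglongrightarrow> 0"
proof -
  have "(\<lambda>n. 4 * exp (u n) * exp (n / 400) * exp (- (n / 200))) \<longlonglongrightarrow> 0"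
    unfolding u_def using assms(1) by real_asymp
  moreover have "(\<lambda>n. B n * (2 * exp (- u n))) \<longlonglongrightarrow> 0"
    unfolding u_def B_def using assms(1) by real_asymp
  moreover have "(\<lambda>n. B n * exp (n / 100) * exp (B n) * exp (- (n / 32))) \<longlonglongrightarrow> 0"
    unfolding B_def using assms(1) by real_asymp
  ultimately show ?thesis by (intro tendsto_add_zero)
qed

lemma div_in_bigomega:
  assumes "k > 0"
  shows "(\<lambda>n. real (n div k)) \<in> \<Omega>(\<lambda>n. real n)"
proof (rule landau_omega.bigI[of "1 / (2 * real k)"])
  show "\<forall>\<^sub>F n in sequentially. 1 / (2 * real k) * norm (real n) \<le> norm (real (n div k))"
    using eventually_ge_at_top[of k]
  proof eventually_elim
    case (elim n)
    have "n mod k < k" using assms by simp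
    also have "k \<le> k * (n div k)" using elim assms by (simp add: Suc_le_eq div_greater_zero_iff)
    finally have "n \<le> 2 * (k * (n div k))" using mult_div_mod_eq[of k n] by linarith
    then have "real n \<le> real (2 * (k * (n div k)))" by (rule of_nat_mono)
    then show ?case using assms by (simp add: field_simps)
  qed
qed (use assms in simp)

text \<open>Since \<open>m \<le> 2 * exp u\<close> and \<open>u \<le> q * n / 8\<close>, the base of
  the union bound is at most \<open>2 * exp (- u)\<close>, which \<open>ln 2 \<le> u\<close> keeps
  below 1. The threshold 1/400 lets \<open>2 ^ d\<close> beat \<open>exp (q * n)\<close>, and
  \<open>n \<ge> 200\<close> makes the degree at least 2.\<close>

lemma prob_not_satisfiable_le_explicit:
  fixes q u B :: real and m n :: nat
  assumes n: "n \<ge> 200" and q: "0 < q" "q \<le> 1 / 400"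
    and B: "1 / (2 * q) \<le> B"
    and u: "ln 2 \<le> u" "u \<le> q * n / 8"
    and m: "m \<le> 2 * exp u"
  shows "measure_pmf.prob (random_matrix m n q)
      {A. \<not> (\<forall>b. \<exists>E. pseudo_expectation n (n div 100) E \<and> satisfies_system m n (n div 100) A b E)}
    \<le> 4 * exp u * exp (n / 400) * exp (- (n / 200)) + B * (2 * exp (- u))
      + B * exp (n / 100) * exp B * exp (- (n / 32))"
proof -
  define d where "d = n div 100"
  \<comment> \<open>The least \<open>r\<close> with \<open>q * r \<ge> 1 / 4\<close>; being less
    than \<open>1 / (4 * q) + 1\<close>, it also gives \<open>2 * q * K \<le> 1\<close>.\<close>
  define r where "r = nat \<lceil>1 / (4 * q)\<rceil>"
  define K where "K = 2 * r - 2"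
  have q100: "100 \<le> 1 / (4 * q)" using q by (simp add: field_simps)
  have r_bounds: "1 / (4 * q) \<le> r" "r < 1 / (4 * q) + 1"
    using q100 unfolding r_def by linarith+
  have r: "2 \<le> r" using r_bounds q100 by linarith
  have K: "K \<le> 1 / (2 * q)"
  proof -
    have "real K = 2 * real r - 2" using r by (simp add: K_def of_nat_diff)
    moreover have "1 / (2 * q) = 2 * (1 / (4 * q))" by simp
    ultimately show ?thesis using r_bounds by linarith
  qed
  have y: "m * exp (- (q * n / 4)) \<le> 2 * exp (u - q * n / 4)"
    using mult_right_mono[OF m, of "exp (- (q * n / 4))"] by (simp add: mult.assoc flip: exp_add)
  have "measure_pmf.prob (random_matrix m n q)
      {A. \<not> (\<forall>b. \<exists>E. pseudo_expectation n d E \<and> satisfies_system m n d A b E)}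
    \<le> m * exp (q * n) / 2 ^ d + K * (2 * exp (- u)) + real K * 2 ^ d * 2 ^ K * exp (- (n / 32))"
    unfolding K_def
  proof (rule prob_not_satisfiable_le)
    show "0 < q" "2 \<le> r" by fact+
    show "2 \<le> d" using n by (simp add: d_def)
    show "2 * q * real (2 * r - 2) \<le> 1" using K q by (simp add: K_def field_simps)
    show "1 / 4 \<le> q * r" using r_bounds(1) q by (simp add: field_simps)
    show "m * exp (- (q * n / 4)) \<le> 2 * exp (- u)"
      by (rule order.trans[OF y]) (use u in simp)
    have "exp (- u) \<le> exp (- ln 2)" using u by simp
    then show "2 * exp (- u) \<le> 1" by (simp add: exp_minus)
    show "m * exp (- (q * n / 4)) \<le> 2 * exp (- (q * n / 8))"
      by (rule order.trans[OF y]) (use u in simp)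
  qed
  also have "m * exp (q * n) / 2 ^ d \<le> 4 * exp u * exp (n / 400) * exp (- (n / 200))"
  proof -
    have "n \<le> 100 * d + 100" by (simp add: d_def)
    \<comment> \<open>Rounding in \<open>n div 100\<close> costs a factor
      \<open>exp (1 / 2) \<le> 2\<close>. With the 2 in the bound on \<open>m\<close> this yields
      the constant 4.\<close>
    then have nd: "real n / 200 - 1 / 2 \<le> d / 2" by linarith
    have half: "exp (1 / 2 :: real) \<le> 2"
    proof -
      have "exp (1 / 2 :: real) \<le> exp (ln 2)"
        unfolding exp_le_cancel_iff using ln2_ge_two_thirds by linarith
      then show ?thesis by simp
    qed
    have "exp (n / 200) \<le> exp (1 / 2) * exp (d / 2)"
      using nd by (simp flip: exp_add)
    also have "exp (d / 2) = exp (1 / 2 :: real) ^ d" by (simp flip: exp_of_nat_mult)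
    also have "exp (1 / 2) * exp (1 / 2 :: real) ^ d \<le> 2 * 2 ^ d"
      using half by (intro mult_mono power_mono) auto
    finally have "1 / 2 ^ d \<le> 2 * exp (- (n / 200))"
      by (simp add: exp_minus field_simps)
    moreover have "exp (q * n) \<le> exp (n / 400)"
      using mult_right_mono[OF q(2), of "real n"] by simp
    ultimately have "m * exp (q * n) * (1 / 2 ^ d) \<le> (2 * exp u) * exp (n / 400) * (2 * exp (- (n / 200)))"
      using m by (intro mult_mono) auto
    then show ?thesis by (simp add: mult_ac)
  qed
  also have "K * (2 * exp (- u)) \<le> B * (2 * exp (- u))"
    using K B by (intro mult_right_mono) auto
  also have "real K * 2 ^ d * 2 ^ K * exp (- (n / 32)) \<le> B * exp (n / 100) * exp B * exp (- (n / 32))"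
  proof -
    have two: "(2::real) ^ k \<le> exp (real k)" for k
      using power_mono[of 2 "exp (1::real)" k] exp_ge_add_one_self[of 1] by (simp flip: exp_of_nat_mult)
    have "real d \<le> n / 100" unfolding d_def by linarith
    then have "2 ^ d \<le> exp (n / 100)" using two[of d] by (meson exp_le_cancel_iff order.trans)
    moreover have "2 ^ K \<le> exp B" using two[of K] K B by (meson exp_le_cancel_iff order.trans)
    moreover have "real K \<le> B" "0 \<le> B" using K B by linarith+
    ultimately show ?thesis by (intro mult_mono mult_nonneg_nonneg) auto
  qed
  finally show ?thesis unfolding d_def by simp
qed

theorem theorem4p2:
  fixes C :: real and lam :: "nat \<Rightarrow> real" and m :: "nat \<Rightarrow> nat"
  assumes "C > 0"
    and "\<And>n. n \<ge> 2 \<Longrightarrow> 1 < lam n"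
    and "lam \<in> o(\<lambda>n. log 2 (real n))"
    and "\<And>n. n \<ge> 2 \<Longrightarrow> \<bar>real (m n) - 2 powr (C * real n / log 2 (real n))\<bar> < 1"
  shows "\<exists>d :: nat \<Rightarrow> nat. (\<lambda>n. real (d n)) \<in> \<Omega>(\<lambda>n. real n) \<and>
    (\<lambda>n. measure_pmf.prob
            (random_matrix (m n) n (lam n * (8 * C * ln 2 / log 2 (real n))))
            {A. \<forall>b. \<exists>E. pseudo_expectation n (d n) E \<and>
                         satisfies_system (m n) n (d n) A b E})
      \<longlonglongrightarrow> 1"
proof (intro exI[of _ "\<lambda>n. n div 100"] conjI)
  show "(\<lambda>n. real (n div 100)) \<in> \<Omega>(\<lambda>n. real n)" by (rule div_in_bigomega) simp
  \<comment> \<open>Passing to natural logarithms: the number of equations is about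
    \<open>exp (c * n / ln n)\<close> and the density is
    \<open>8 * c * lam n / ln n\<close>.\<close>
  define c where "c = C * (ln 2)\<^sup>2"
  define q where "q n = lam n * (8 * C * ln 2 / log 2 (real n))" for n
  define u where "u n = c * real n / ln (real n)" for n
  define B where "B n = ln (real n) / (16 * c)" for n
  \<comment> \<open>The quantifier over \<open>b\<close> is inside the event, so a single good
    matrix serves all right-hand sides at once.\<close>
  define good where "good n = {A. \<forall>b. \<exists>E. pseudo_expectation n (n div 100) E \<and>
    satisfies_system (m n) n (n div 100) A b E}" for n
  define bound where "bound n = 4 * exp (u n) * exp (n / 400) * exp (- (n / 200))
    + B n * (2 * exp (- u n)) + B n * exp (n / 100) * exp (B n) * exp (- (n / 32))" for n
  have c: "c > 0" using assms(1) by (simp add: c_def)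
  have bound_0: "bound \<longlonglongrightarrow> 0"
    unfolding bound_def u_def B_def by (rule failure_bound_tendsto_0[OF c])
  have "(\<lambda>n. 8 * C * ln 2 * (lam n / log 2 (real n))) \<longlonglongrightarrow> 8 * C * ln 2 * 0"
    by (intro tendsto_mult_left smalloD_tendsto assms(3))
  moreover have "q = (\<lambda>n. 8 * C * ln 2 * (lam n / log 2 (real n)))"
    by (simp add: q_def fun_eq_iff)
  ultimately have "q \<longlonglongrightarrow> 0" by simp
  then have q_small: "\<forall>\<^sub>F n in sequentially. q n < 1 / 400"
    by (rule order_tendstoD) simp
  have "filterlim u at_top sequentially"
    unfolding u_def using c by real_asymp
  then have u_large: "\<forall>\<^sub>F n in sequentially. ln 2 \<le> u n"
    by (simp add: filterlim_at_top)
  have lower: "\<forall>\<^sub>F n in sequentially. 1 - bound n \<le> measure_pmf.prob (random_matrix (m n) n (q n)) (good n)"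
    using q_small u_large eventually_ge_at_top[of 200]
  proof eventually_elim
    case (elim n)
    have ln: "ln (real n) > 0" and lam: "1 < lam n" using elim assms(2) by auto
    have q_eq: "q n = 8 * c * lam n / ln n"
      using ln by (simp add: q_def c_def log_def power2_eq_square)
    \<comment> \<open>The factor 8 in the density and \<open>lam n > 1\<close> are what make
      \<open>u n \<le> q n * n / 8\<close>; the same bound gives
      \<open>1 / (2 * q n) \<le> B n\<close>.\<close>
    have q: "8 * c / ln n < q n"
      using c ln lam unfolding q_eq by (intro divide_strict_right_mono) auto
    have q_pos: "0 < q n" by (rule le_less_trans[OF _ q]) (use c ln in simp)
    have "measure_pmf.prob (random_matrix (m n) n (q n)) (- good n) \<le> bound n"
      unfolding bound_def good_def Collect_neg_eq[symmetric]
    proof (rule prob_not_satisfiable_le_explicit)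
      show "200 \<le> n" "0 < q n" "ln 2 \<le> u n" "q n \<le> 1 / 400" using elim q_pos by auto
      have "1 / q n \<le> 1 / (8 * c / ln n)"
        using q q_pos c ln by (intro divide_left_mono mult_pos_pos divide_pos_pos) auto
      then show "1 / (2 * q n) \<le> B n" by (simp add: B_def)
      show "u n \<le> q n * n / 8"
        using mult_right_mono[OF less_imp_le[OF q], of "real n"] by (simp add: u_def mult_ac)
      have "2 powr (C * n / log 2 n) = exp (u n)"
        using ln by (simp add: powr_def u_def c_def log_def power2_eq_square)
      \<comment> \<open>Rounding \<open>m n\<close> to an integer costs at most 1, absorbed into the
        factor 2 because \<open>exp (u n) \<ge> 1\<close>.\<close>
      then have "m n \<le> exp (u n) + 1" using assms(4)[of n] elim by simp
      moreover have "1 \<le> exp (u n)"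
        using c ln by (simp add: u_def)
      ultimately show "m n \<le> 2 * exp (u n)" by linarith
    qed
    moreover have "measure_pmf.prob (random_matrix (m n) n (q n)) (- good n)
        = 1 - measure_pmf.prob (random_matrix (m n) n (q n)) (good n)"
      using measure_pmf.prob_compl[of "good n" "random_matrix (m n) n (q n)"] by (simp add: Compl_eq_Diff_UNIV)
    ultimately show ?case by linarith
  qed
  have "(\<lambda>n. measure_pmf.prob (random_matrix (m n) n (q n)) (good n)) \<longlonglongrightarrow> 1"
  proof (rule tendsto_sandwich[OF lower])
    show "(\<lambda>n. 1 - bound n) \<longlonglongrightarrow> 1"
      using tendsto_diff[OF tendsto_const bound_0, of 1] by simp
  qed auto
  then show "(\<lambda>n. measure_pmf.prob
            (random_matrix (m n) n (lam n * (8 * C * ln 2 / log 2 (real n))))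
            {A. \<forall>b. \<exists>E. pseudo_expectation n (n div 100) E \<and>
                         satisfies_system (m n) n (n div 100) A b E}) \<longlonglongrightarrow> 1"
    unfolding q_def good_def .
qed

end
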